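(* Let $b>0$, $\nu\in\mathbb{R}$ with $1+b\nu>0$, let $w\in\mathbb{C}\setminus\{0\}$, $w=|w|e^{\sqrt{-1}\alpha}$, let $t\in[-1,1]$, and let $\epsilon>0$. Then $$\mathscr{I}(b,\nu,w,t)=\frac{\Gamma(b\nu+1)}{2\pi i}\left(\frac{w}{2}\right)^{-b\nu}\int_{C_{\epsilon,w}}z^{-b\nu}\,\frac{1-z^{-2b}}{\left(1-2tz^{-b}+z^{-2b}\right)^{\nu+1}}\,e^{\frac{w}{2}\left(z+\frac1z\right)}\,\frac{dz}{z}.$$ Here the integration path $C_{\epsilon,w}$ is the concatenation of the following three paths: ($C_1$) the half line from $(+\infty)e^{\sqrt{-1}(-\alpha-\pi)}$ to $(1+\epsilon)e^{\sqrt{-1}(-\alpha-\pi)}$; ($C_2$) the counterclockwise circle of radius $1+\epsilon$ centered at $0$ from $(1+\epsilon)e^{\sqrt{-1}(-\alpha-\pi)}$ to $(1+\epsilon)e^{\sqrt{-1}(-\alpha+\pi)}$; ($C_3$) the half line from $(1+\epsilon)e^{\sqrt{-1}(-\alpha+\pi)}$ to $(+\infty)e^{\sqrt{-1}(-\alpha+\pi)}$.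
   Context: Normalized I-Bessel function: for $\mu\in\mathbb{R}$ and $w\in\mathbb{C}$, $\tilde I_\mu(w)=\sum_{j=0}^\infty\frac{(w/2)^{2j}}{j!\,\Gamma(\mu+j+1)}$ (with $1/\Gamma=0$ at the poles of $\Gamma$). Normalized Gegenbauer polynomials $\check C^\nu_m(t)$ ($\nu\in\mathbb{R}$, $m\in\mathbb{N}=\{0,1,2,\dots\}$) are defined by the formal power series expansion $\frac{1-x^2}{(1-2tx+x^2)^{\nu+1}}=\sum_{m=0}^\infty\check C^\nu_m(t)x^m$. For $b>0$, $\nu\in\mathbb{R}$ with $1+b\nu>0$, $w\in\mathbb{C}$, $t\in[-1,1]$, $$\mathscr{I}(b,\nu,w,t):=\Gamma(b\nu+1)\sum_{m=0}^\infty\left(\frac w2\right)^{bm}\tilde I_{b(m+\nu)}(w)\,\check C^\nu_m(t),$$ a series which converges absolutely and locally uniformly. Branches: with $w=|w|e^{\sqrt{-1}\alpha}$, $\alpha\in(-\pi,\pi]$, real powers of $w/2$ are $(w/2)^s=(|w|/2)^se^{\sqrt{-1}\alpha s}$, and along $C_{\epsilon,w}$ real powers of $z$ are $z^s=|z|^se^{\sqrt{-1}s\arg z}$ with $\arg z=-\alpha-\pi$ on $C_1$, $\arg z$ increasing continuously from $-\alpha-\pi$ to $-\alpha+\pi$ on $C_2$, and $\arg z=-\alpha+\pi$ on $C_3$. The power $(1-2tz^{-b}+z^{-2b})^{\nu+1}$ is the principal one (the value continuing the power series in $x=z^{-b}$, $|x|<1$, with value $1$ at $x=0$). *)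

theory Defs
  imports "HOL-Analysis.Analysis"
begin

definition norm_bessel_I :: "real \<Rightarrow> complex \<Rightarrow> complex" where
  "norm_bessel_I \<mu> w =
     (\<Sum>j. (w / 2) ^ (2 * j) / fact j * rGamma (complex_of_real \<mu> + of_nat j + 1))"

text \<open>
  \<^const>\<open>fps_binomial\<close> \<open>a\<close> is the formal power series \<open>(1 + X)\<^sup>a\<close>, so composing it with
  \<open>X\<^sup>2 - 2tX\<close>, which has no constant term, gives the formal power \<open>(1 - 2tX + X\<^sup>2)\<^sup>a\<close>.
\<close>

definition norm_gegenbauer :: "real \<Rightarrow> nat \<Rightarrow> real \<Rightarrow> real" where
  "norm_gegenbauer \<nu> m t =
     fps_nth ((1 - fps_X ^ 2) /
       fps_compose (fps_binomial (\<nu> + 1)) (fps_X ^ 2 - fps_const (2 * t) * fps_X)) m"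

text \<open>
  Real powers of a complex number on the branch \<open>-\<pi> < arg \<le> \<pi>\<close>. This is \<open>powr\<close>,
  except that \<open>0 powr 0 = 0\<close> in the library, whereas the convention \<open>0\<^sup>0 = 1\<close> is needed for the
  series below at \<open>w = 0\<close>.
\<close>

definition real_pow :: "complex \<Rightarrow> real \<Rightarrow> complex" where
  "real_pow z s = (if s = 0 then 1 else z powr complex_of_real s)"

definition script_I :: "real \<Rightarrow> real \<Rightarrow> complex \<Rightarrow> real \<Rightarrow> complex" where
  "script_I b \<nu> w t = complex_of_real (Gamma (b * \<nu> + 1)) *
     (\<Sum>m. real_pow (w / 2) (b * real m) * norm_bessel_I (b * (real m + \<nu>)) w *
           complex_of_real (norm_gegenbauer \<nu> m t))"

text \<open>
  The integrand is multivalued in \<open>z\<close>, since the argument of \<open>z\<close> increases by \<open>2\<pi>\<close> along the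
  contour. It is therefore a function of the modulus \<open>r\<close> and the chosen argument \<open>\<theta>\<close> of
  \<open>z = rcis r \<theta>\<close>; \<open>polar_pow r \<theta> s\<close> is \<open>z\<^sup>s\<close> on that branch.
\<close>

definition polar_pow :: "real \<Rightarrow> real \<Rightarrow> real \<Rightarrow> complex" where
  "polar_pow r \<theta> s = rcis (r powr s) (s * \<theta>)"

text \<open>
  The principal power of \<open>1 - 2tx + x\<^sup>2\<close>, \<open>x = z\<^sup>-\<^sup>b\<close>, is the analytic continuation from \<open>x = 0\<close>: for
  \<open>t = cos \<phi>\<close> and \<open>norm x < 1\<close> it factors into \<open>1 - x cis \<phi>\<close> and \<open>1 - x cis (-\<phi>)\<close>, both with
  positive real part, so that its argument stays inside \<open>(-\<pi>, \<pi>)\<close>.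
\<close>

definition contour_integrand :: "real \<Rightarrow> real \<Rightarrow> complex \<Rightarrow> real \<Rightarrow> real \<Rightarrow> real \<Rightarrow> complex" where
  "contour_integrand b \<nu> w t r \<theta> =
     polar_pow r \<theta> (- (b * \<nu>)) *
     ((1 - polar_pow r \<theta> (- 2 * b)) /
       (1 - 2 * complex_of_real t * polar_pow r \<theta> (- b) + polar_pow r \<theta> (- 2 * b))
         powr complex_of_real (\<nu> + 1)) *
     exp (w / 2 * (rcis r \<theta> + 1 / rcis r \<theta>)) / rcis r \<theta>"

text \<open>
  The contour integral of \<open>F\<close> (a function of modulus and argument): the incoming ray
  \<open>\<theta> = -\<alpha> - \<pi>\<close>, the circle of radius \<open>1 + \<epsilon>\<close>, the outgoing ray \<open>\<theta> = -\<alpha> + \<pi>\<close>. The line element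
  \<open>dz\<close> is \<open>cis \<theta> dr\<close> on the rays and \<open>\<i> rcis r \<theta> d\<theta>\<close> on the circle.
\<close>

definition hankel_integrable :: "(real \<Rightarrow> real \<Rightarrow> complex) \<Rightarrow> real \<Rightarrow> real \<Rightarrow> bool" where
  "hankel_integrable F \<epsilon> \<alpha> \<longleftrightarrow>
     (\<lambda>r. F r (- \<alpha> - pi) * cis (- \<alpha> - pi)) integrable_on {1 + \<epsilon>..} \<and>
     (\<lambda>\<theta>. F (1 + \<epsilon>) \<theta> * (\<i> * rcis (1 + \<epsilon>) \<theta>)) integrable_on {- \<alpha> - pi..- \<alpha> + pi} \<and>
     (\<lambda>r. F r (- \<alpha> + pi) * cis (- \<alpha> + pi)) integrable_on {1 + \<epsilon>..}"

definition hankel_integral :: "(real \<Rightarrow> real \<Rightarrow> complex) \<Rightarrow> real \<Rightarrow> real \<Rightarrow> complex" where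
  "hankel_integral F \<epsilon> \<alpha> =
     - integral {1 + \<epsilon>..} (\<lambda>r. F r (- \<alpha> - pi) * cis (- \<alpha> - pi)) +
     integral {- \<alpha> - pi..- \<alpha> + pi} (\<lambda>\<theta>. F (1 + \<epsilon>) \<theta> * (\<i> * rcis (1 + \<epsilon>) \<theta>)) +
     integral {1 + \<epsilon>..} (\<lambda>r. F r (- \<alpha> + pi) * cis (- \<alpha> + pi))"

end

theory Submission
  imports Defs "HOL-Complex_Analysis.Complex_Analysis"
begin

text \<open>
  Inserting the generating function of the Gegenbauer polynomials at \<open>x = z\<^sup>-\<^sup>b\<close>, where
  \<open>norm x \<le> (1 + \<epsilon>)\<^sup>-\<^sup>b < 1\<close>, and integrating term by term reduces the claim to Schlaefli's integral for
  \<open>I\<^sub>\<mu>\<close> with \<open>\<mu> = b (m + \<nu>) > -1\<close>. Expanding \<open>exp (w / (2 z))\<close> there reduces it in turn to Hankel's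
  integral of \<open>z\<^sup>-\<^sup>s exp (w z / 2)\<close> for \<open>s = \<mu> + j + 1 > 0\<close>. All interchanges are dominated by
  \<open>exp (Re (w z / 2))\<close>.

  Integration by parts shifts \<open>s\<close> by 1, so Hankel's formula is needed only for \<open>0 < s \<le> 1\<close>. There the
  derivatives of the circular part and of the rays with respect to the radius of the circle cancel;
  letting the radius tend to 0 leaves the Gamma integral on the rays if \<open>s < 1\<close>, where the reflection
  formula gives \<open>1 / \<Gamma>(s)\<close>, and the bare circle if \<open>s = 1\<close>.
\<close>

subsection \<open>The generating function of the Gegenbauer polynomials\<close>

definition fps_complex :: "real fps \<Rightarrow> complex fps" where
  "fps_complex f = Abs_fps (\<lambda>n. complex_of_real (fps_nth f n))"

lemma fps_nth_fps_complex [simp]: "fps_nth (fps_complex f) n = complex_of_real (fps_nth f n)"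
  by (simp add: fps_complex_def)

lemma fps_complex_1 [simp]: "fps_complex 1 = 1"
  by (simp add: fps_eq_iff)

lemma fps_complex_const [simp]: "fps_complex (fps_const c) = fps_const (complex_of_real c)"
  by (simp add: fps_eq_iff)

lemma fps_complex_X [simp]: "fps_complex fps_X = fps_X"
  by (simp add: fps_eq_iff fps_X_nth)

lemma fps_complex_diff: "fps_complex (f - g) = fps_complex f - fps_complex g"
  by (simp add: fps_eq_iff)

lemma fps_complex_mult: "fps_complex (f * g) = fps_complex f * fps_complex g"
  by (simp add: fps_eq_iff fps_mult_nth)

lemma fps_complex_power: "fps_complex (f ^ n) = fps_complex f ^ n"
  by (induction n) (simp_all add: fps_complex_mult)

lemma fps_complex_compose: "fps_complex (fps_compose f g) = fps_compose (fps_complex f) (fps_complex g)"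
  by (simp add: fps_eq_iff fps_compose_nth flip: fps_complex_power)

lemma complex_of_real_gchoose: "complex_of_real (a gchoose n) = complex_of_real a gchoose n"
  by (simp add: gbinomial_prod_rev)

lemma fps_complex_binomial: "fps_complex (fps_binomial a) = fps_binomial (complex_of_real a)"
  by (simp add: fps_eq_iff complex_of_real_gchoose)

text \<open>A nonzero constant term makes \<open>g\<close> a unit, so the division is exact:
  \<open>f = (f / g) * g\<close> passes through \<open>fps_complex\<close>, and the nonzero image of
  \<open>g\<close> cancels.\<close>

lemma fps_complex_divide_unit:
  assumes "fps_nth g 0 \<noteq> 0"
  shows "fps_complex (f / g) = fps_complex f / fps_complex g"
proof -
  have "f = (f / g) * g"
    using assms by (simp add: fps_divide_unit mult.assoc inverse_mult_eq_1)
  then have "fps_complex f = fps_complex (f / g) * fps_complex g"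
    by (metis fps_complex_mult)
  moreover have "fps_complex g \<noteq> 0"
    using assms by (metis fps_nth_fps_complex fps_zero_nth of_real_eq_0_iff)
  ultimately show ?thesis
    by simp
qed

text \<open>The imaginary part 2 Im x (Re x - t) vanishes only for real x, where the value is at
  least (1 - |x|)^2, and for Re x = t, where it equals 1 - |x|^2; both are positive. Hence the
  principal power of the quadratic is holomorphic in the open unit disc.\<close>

lemma gegenbauer_quadratic_not_nonpos:
  fixes x :: complex
  assumes t: "\<bar>t\<bar> \<le> 1" and x: "norm x < 1"
  shows "1 - 2 * complex_of_real t * x + x\<^sup>2 \<notin> \<real>\<^sub>\<le>\<^sub>0"
proof
  assume "1 - 2 * complex_of_real t * x + x\<^sup>2 \<in> \<real>\<^sub>\<le>\<^sub>0"
  then have re: "1 - 2 * t * Re x + ((Re x)\<^sup>2 - (Im x)\<^sup>2) \<le> 0"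
    and im: "2 * Im x * (Re x - t) = 0"
    by (auto simp: complex_nonpos_Reals_iff power2_eq_square algebra_simps)
  have nx: "(Re x)\<^sup>2 + (Im x)\<^sup>2 < 1"
    using x abs_square_less_1[of "norm x"] by (simp add: cmod_power2)
  from im consider "Im x = 0" | "Re x = t" by auto
  then show False
  proof cases
    case 1
    have "\<bar>Re x\<bar> < 1"
      using x abs_Re_le_cmod[of x] by linarith
    then have "0 < (1 - \<bar>Re x\<bar>)\<^sup>2" by simp
    also have "\<dots> = 1 - 2 * \<bar>Re x\<bar> + (Re x)\<^sup>2"
      by (simp add: power2_eq_square algebra_simps)
    also have "t * Re x \<le> \<bar>Re x\<bar>"
      using mult_mono[OF t order_refl[of "\<bar>Re x\<bar>"]] by (simp add: flip: abs_mult)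
    then have "1 - 2 * \<bar>Re x\<bar> + (Re x)\<^sup>2 \<le> 1 - 2 * t * Re x + (Re x)\<^sup>2"
      by simp
    finally show False using re 1 by simp
  next
    case 2
    then show False using re nx by (simp add: power2_eq_square)
  qed
qed

text \<open>The formal identity yields an expansion near 0; holomorphy on the whole unit disc makes
  the same series converge to the function throughout the disc.\<close>

lemma norm_gegenbauer_sums:
  fixes x :: complex
  assumes t: "\<bar>t\<bar> \<le> 1" and x: "norm x < 1"
  shows "(\<lambda>m. complex_of_real (norm_gegenbauer \<nu> m t) * x ^ m) sums
    ((1 - x\<^sup>2) / (1 - 2 * complex_of_real t * x + x\<^sup>2) powr complex_of_real (\<nu> + 1))"
proof -
  define G where "G = fps_compose (fps_binomial (\<nu> + 1)) (fps_X ^ 2 - fps_const (2 * t) * fps_X)"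
  define F where "F = fps_complex ((1 - fps_X ^ 2) / G)"
  define f where "f = (\<lambda>x::complex. (1 - x\<^sup>2) /
    (1 - 2 * complex_of_real t * x + x\<^sup>2) powr complex_of_real (\<nu> + 1))"
  have G': "fps_complex G = fps_compose (fps_binomial (complex_of_real (\<nu> + 1)))
      (fps_X ^ 2 - fps_const (complex_of_real (2 * t)) * fps_X)"
    unfolding G_def fps_complex_compose fps_complex_binomial
    by (simp only: fps_complex_diff fps_complex_mult fps_complex_power fps_complex_X fps_complex_const)
  have G0: "fps_nth G 0 = 1"
    by (simp add: G_def)
  have F: "F = (1 - fps_X ^ 2) / fps_complex G"
    unfolding F_def using G0
    by (subst fps_complex_divide_unit) (simp_all add: fps_complex_diff fps_complex_power)
  have "((\<lambda>x. (1 + x) powr complex_of_real (\<nu> + 1)) \<circ> (\<lambda>x. x ^ 2 - complex_of_real (2 * t) * x))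
      has_fps_expansion fps_complex G"
    unfolding G'
    by (intro has_fps_expansion_compose fps_expansion_intros) simp_all
  then have G'': "(\<lambda>x. (1 - 2 * complex_of_real t * x + x\<^sup>2) powr complex_of_real (\<nu> + 1))
      has_fps_expansion fps_complex G"
    by (simp add: o_def algebra_simps)
  have "f has_fps_expansion F"
    unfolding F f_def using G0
    by (intro has_fps_expansion_divide' G'' fps_expansion_intros) simp
  moreover have "f holomorphic_on eball 0 1"
    unfolding f_def
  proof (intro holomorphic_intros)
    fix z :: complex assume "z \<in> eball 0 1"
    then have "norm z < 1" by (simp add: one_ereal_def)
    from gegenbauer_quadratic_not_nonpos[OF t this]
    show "1 - 2 * complex_of_real t * z + z\<^sup>2 \<notin> \<real>\<^sub>\<le>\<^sub>0"
      and "(1 - 2 * complex_of_real t * z + z\<^sup>2) powr complex_of_real (\<nu> + 1) \<noteq> 0"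
      by auto
  qed
  moreover have "ereal (norm x) < 1"
    using x by (simp add: one_ereal_def)
  ultimately have "(\<lambda>n. fps_nth F n * x ^ n) sums f x"
    by (rule has_fps_expansion_imp_sums_complex)
  then show ?thesis
    by (simp add: F_def G_def f_def norm_gegenbauer_def)
qed

text \<open>A power series converges absolutely strictly inside any point of convergence, and the
  generating function provides one at some \<open>q\<close> between \<open>r\<close> and 1.\<close>

lemma summable_norm_gegenbauer:
  fixes r :: real
  assumes t: "\<bar>t\<bar> \<le> 1" and r: "0 \<le> r" "r < 1"
  shows "summable (\<lambda>m. \<bar>norm_gegenbauer \<nu> m t\<bar> * r ^ m)"
proof -
  obtain q where q: "r < q" "q < 1" using dense[OF r(2)] by blast
  with r have "norm (complex_of_real q) < 1" by simp
  from norm_gegenbauer_sums[OF t this]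
  have "summable (\<lambda>m. complex_of_real (norm_gegenbauer \<nu> m t) * complex_of_real q ^ m)"
    by (rule sums_summable)
  then have "summable (\<lambda>m. norm (complex_of_real (norm_gegenbauer \<nu> m t) * complex_of_real r ^ m))"
    by (rule powser_insidea) (use q r in simp)
  then show ?thesis
    using r by (simp add: norm_mult norm_power)
qed

subsection \<open>Hankel's integral\<close>

lemma integral_atLeast_FTC:
  fixes f f' :: "real \<Rightarrow> complex"
  assumes deriv: "\<And>x. x \<ge> a \<Longrightarrow> (f has_vector_derivative f' x) (at x within {a..})"
    and int: "f' absolutely_integrable_on {a..}"
    and lim: "(f \<longlongrightarrow> l) at_top"
  shows "integral {a..} f' = l - f a"
proof -
  \<comment> \<open>Truncations of \<open>f'\<close>: each is integrated by the fundamental theorem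
    on a compact interval, and the norm of \<open>f'\<close> dominates them all.\<close>
  define F where "F = (\<lambda>k x. if x \<in> {a..a + real k} then f' x else 0)"
  have F: "(F k has_integral (f (a + real k) - f a)) {a..}" for k
  proof -
    have "(f' has_integral (f (a + real k) - f a)) {a..a + real k}"
      by (rule fundamental_theorem_of_calculus)
        (auto intro: has_vector_derivative_within_subset[OF deriv])
    then show ?thesis
      unfolding F_def by (subst has_integral_restrict) auto
  qed
  have "(\<lambda>k. integral {a..} (F k)) \<longlonglongrightarrow> integral {a..} f'"
  proof (rule dominated_convergence(2))
    show "F k integrable_on {a..}" for k
      using F by blast
    show "(\<lambda>x. norm (f' x)) integrable_on {a..}"
      using int by (simp add: absolutely_integrable_on_def)
    show "norm (F k x) \<le> norm (f' x)" for k x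
      by (simp add: F_def)
    show "(\<lambda>k. F k x) \<longlonglongrightarrow> f' x" if "x \<in> {a..}" for x
    proof (rule tendsto_eventually)
      show "\<forall>\<^sub>F k in sequentially. F k x = f' x"
        using eventually_ge_at_top[of "nat \<lceil>x - a\<rceil>"]
        by eventually_elim (use that in \<open>auto simp: F_def nat_ceiling_le_eq\<close>)
    qed
  qed
  then have "(\<lambda>k. f (a + real k) - f a) \<longlonglongrightarrow> integral {a..} f'"
    by (simp add: integral_unique[OF F])
  moreover have "filterlim (\<lambda>k. a + real k) at_top sequentially"
    by (intro filterlim_tendsto_add_at_top[OF tendsto_const] filterlim_real_sequentially)
  then have "(\<lambda>k. f (a + real k) - f a) \<longlonglongrightarrow> l - f a"
    by (intro tendsto_intros filterlim_compose[OF lim])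
  ultimately show ?thesis
    by (rule LIMSEQ_unique)
qed

text \<open>Euler's integral for Gamma(1 - s) under the substitution t = c r; s < 1 is its
  convergence at 0.\<close>

lemma integral_Gamma_scaled:
  fixes c s :: real
  assumes c: "c > 0" and s: "s < 1"
  shows "((\<lambda>r. r powr (-s) * exp (- (c * r))) has_integral (Gamma (1 - s) * c powr (s - 1))) {0..}"
proof -
  define f where "f = (\<lambda>t::real. t powr (-s) / exp t)"
  have f: "(f has_integral Gamma (1 - s)) {0..}"
    using Gamma_integral_real[of "1 - s"] s by (simp add: f_def)
  have img: "(\<lambda>x. c * x) ` {0..} = {0..}"
  proof -
    have "y \<in> (\<lambda>x. c * x) ` {0..}" if "y \<ge> 0" for y
      by (rule image_eqI[of _ _ "y / c"]) (use c that in auto)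
    then show ?thesis using c by auto
  qed
  have "f absolutely_integrable_on {0..}"
    by (rule nonnegative_absolutely_integrable_1) (use f in \<open>auto simp: f_def\<close>)
  moreover have "integral {0..} f = Gamma (1 - s)"
    using f by (rule integral_unique)
  moreover have "{0::real..} \<in> sets lebesgue" by simp
  ultimately have "(\<lambda>x. \<bar>c\<bar> * f (c * x)) absolutely_integrable_on {0..} \<and>
      integral {0..} (\<lambda>x. \<bar>c\<bar> * f (c * x)) = Gamma (1 - s)"
    using c by (subst has_absolute_integral_change_of_variables_1'[where g = "\<lambda>x. c * x"])
      (auto intro!: derivative_eq_intros inj_onI simp: img)
  then have "((\<lambda>x. \<bar>c\<bar> * f (c * x)) has_integral Gamma (1 - s)) {0..}"
    by (auto simp: has_integral_iff absolutely_integrable_on_def)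
  then have "((\<lambda>x. c powr (s - 1) * (\<bar>c\<bar> * f (c * x))) has_integral c powr (s - 1) * Gamma (1 - s)) {0..}"
    by (rule has_integral_mult_right)
  moreover have "c powr (s - 1) * (\<bar>c\<bar> * f (c * x)) = x powr (-s) * exp (- (c * x))" if "x \<ge> 0" for x
  proof -
    have "c powr (s - 1) * c * c powr (- s) = 1"
      using c by (simp add: powr_diff powr_minus field_simps)
    moreover have "c powr (s - 1) * (\<bar>c\<bar> * f (c * x)) =
        (c powr (s - 1) * c * c powr (- s)) * x powr (-s) * exp (- (c * x))"
      using c that by (simp add: f_def powr_mult exp_minus field_simps)
    ultimately show ?thesis by simp
  qed
  ultimately show ?thesis
    by (subst mult.commute[of "Gamma (1 - s)"]) (rule has_integral_eq, auto)
qed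

section \<open>Hankel's integrand on the contour\<close>

definition exp_kernel :: "complex \<Rightarrow> real \<Rightarrow> real \<Rightarrow> real \<Rightarrow> complex" where
  "exp_kernel w s r \<theta> = polar_pow r \<theta> (- s) * exp (w / 2 * rcis r \<theta>)"

lemma norm_polar_pow: "norm (polar_pow r \<theta> s) = r powr s"
  by (simp add: polar_pow_def)

lemma polar_pow_add:
  "polar_pow r \<theta> (s + u) = polar_pow r \<theta> s * polar_pow r \<theta> u"
  by (simp add: polar_pow_def rcis_mult powr_add algebra_simps)

lemma polar_pow_1: "r > 0 \<Longrightarrow> polar_pow r \<theta> 1 = rcis r \<theta>"
  by (simp add: polar_pow_def)

lemma polar_pow_minus: "r > 0 \<Longrightarrow> polar_pow r \<theta> (- s) = inverse (polar_pow r \<theta> s)"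
  by (simp add: polar_pow_def powr_minus_divide rcis_inverse)

lemma polar_pow_of_nat_mult: "r > 0 \<Longrightarrow> polar_pow r \<theta> (real n * s) = polar_pow r \<theta> s ^ n"
  by (simp add: polar_pow_def DeMoivre2 powr_powr[symmetric] powr_realpow mult_ac)

lemma continuous_on_exp_kernel_ray:
  "S \<subseteq> {0<..} \<Longrightarrow> continuous_on S (\<lambda>r. exp_kernel w s r \<theta>)"
  unfolding exp_kernel_def polar_pow_def
  by (intro continuous_intros) auto

lemma continuous_on_exp_kernel_circle: "continuous_on S (\<lambda>\<theta>. exp_kernel w s r \<theta>)"
  unfolding exp_kernel_def polar_pow_def
  by (intro continuous_intros) auto

lemma mult_rcis_ray:
  assumes "w / 2 * cis \<theta> = - complex_of_real c"
  shows "w / 2 * rcis r \<theta> = complex_of_real (- (c * r))"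
proof -
  have "w / 2 * rcis r \<theta> = complex_of_real r * (w / 2 * cis \<theta>)"
    by (simp add: rcis_def)
  also have "\<dots> = complex_of_real (- (c * r))"
    unfolding assms by simp
  finally show ?thesis .
qed

lemma exp_kernel_ray:
  assumes "w / 2 * cis \<theta> = - complex_of_real c"
  shows "exp_kernel w s r \<theta> = complex_of_real (r powr (- s) * exp (- (c * r))) * cis (- s * \<theta>)"
  unfolding exp_kernel_def polar_pow_def mult_rcis_ray[OF assms] exp_of_real by (simp add: rcis_def)

text \<open>As s >= 0, the power is at most its value at the finite end of the ray, so a multiple of
  exp(- c r) dominates.\<close>

lemma absolutely_integrable_exp_kernel_ray:
  assumes w: "w / 2 * cis \<theta> = - complex_of_real c" and "c > 0" "\<rho> > 0" "s \<ge> 0"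
  shows "(\<lambda>r. exp_kernel w s r \<theta> * C) absolutely_integrable_on {\<rho>..}"
proof (rule measurable_bounded_by_integrable_imp_absolutely_integrable)
  show "(\<lambda>r. exp_kernel w s r \<theta> * C) \<in> borel_measurable (lebesgue_on {\<rho>..})"
    using \<open>\<rho> > 0\<close>
    by (intro continuous_imp_measurable_on_sets_lebesgue continuous_intros continuous_on_exp_kernel_ray) auto
  show "(\<lambda>r. \<rho> powr (- s) * norm C * exp (- c * r)) integrable_on {\<rho>..}"
    using \<open>c > 0\<close> by (intro integrable_on_mult_right integrable_on_exp_minus_to_infinity)
  fix r assume "r \<in> {\<rho>..}"
  then have "r powr (- s) \<le> \<rho> powr (- s)"
    using assms by (intro powr_mono2') auto
  then show "norm (exp_kernel w s r \<theta> * C) \<le> \<rho> powr (- s) * norm C * exp (- c * r)"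
    using mult_right_mono[of "r powr (- s)" "\<rho> powr (- s)" "norm C * exp (- c * r)"]
    by (simp add: exp_kernel_ray[OF w] norm_mult mult_ac)
qed auto

text \<open>The arguments of the two rays differ by 2 pi; on either of them arg w + arg z is -pi or
  pi, so for nonzero w the product w z is a negative real number.\<close>

lemma cis_ray:
  assumes "w = rcis (norm w) \<alpha>"
  shows "w / 2 * cis (- \<alpha> - pi) = - complex_of_real (norm w / 2)"
    and "w / 2 * cis (- \<alpha> + pi) = - complex_of_real (norm w / 2)"
proof -
  have "w = complex_of_real (norm w) * cis \<alpha>"
    using assms by (simp add: rcis_def)
  then have *: "w / 2 * cis \<theta> = complex_of_real (norm w / 2) * cis (\<alpha> + \<theta>)" for \<theta>
    by (metis (no_types, opaque_lifting) cis_mult mult.assoc of_real_divide of_real_numeral times_divide_eq_left)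
  show "w / 2 * cis (- \<alpha> - pi) = - complex_of_real (norm w / 2)"
    and "w / 2 * cis (- \<alpha> + pi) = - complex_of_real (norm w / 2)"
    unfolding * by (simp_all add: complex_eq_iff)
qed

text \<open>The condition \<open>\<epsilon> > -1\<close> says that the circle has positive radius,
  so that the path avoids the origin.\<close>

lemma hankel_integrable_exp_kernel:
  assumes "w \<noteq> 0" "w = rcis (norm w) \<alpha>" "\<epsilon> > -1" "s \<ge> 0"
  shows "hankel_integrable (exp_kernel w s) \<epsilon> \<alpha>"
  unfolding hankel_integrable_def
proof (intro conjI)
  show "(\<lambda>r. exp_kernel w s r (- \<alpha> - pi) * cis (- \<alpha> - pi)) integrable_on {1 + \<epsilon>..}"
    using absolutely_integrable_exp_kernel_ray[OF cis_ray(1)[OF assms(2)], of "1 + \<epsilon>" s] assms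
    by (auto simp: absolutely_integrable_on_def)
  show "(\<lambda>r. exp_kernel w s r (- \<alpha> + pi) * cis (- \<alpha> + pi)) integrable_on {1 + \<epsilon>..}"
    using absolutely_integrable_exp_kernel_ray[OF cis_ray(2)[OF assms(2)], of "1 + \<epsilon>" s] assms
    by (auto simp: absolutely_integrable_on_def)
  show "(\<lambda>\<theta>. exp_kernel w s (1 + \<epsilon>) \<theta> * (\<i> * rcis (1 + \<epsilon>) \<theta>)) integrable_on {- \<alpha> - pi..- \<alpha> + pi}"
    by (intro integrable_continuous_interval continuous_intros continuous_on_exp_kernel_circle)
qed

section \<open>Integration by parts along the contour\<close>

lemma exp_kernel_Suc:
  "r > 0 \<Longrightarrow> exp_kernel w (s + 1) r \<theta> * rcis r \<theta> = exp_kernel w s r \<theta>"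
  using polar_pow_add[of r \<theta> "- (s + 1)" 1]
  by (simp add: exp_kernel_def polar_pow_1 mult_ac)

text \<open>The complex derivative of z^(-s) exp(w z / 2), times dz/dr; the last factor is the line
  element that \<open>hankel_integral\<close> has on the rays.\<close>

lemma has_vector_derivative_exp_kernel_ray:
  assumes "r > 0"
  shows "((\<lambda>r. exp_kernel w s r \<theta>) has_vector_derivative
    (w / 2 * exp_kernel w s r \<theta> - s * exp_kernel w (s + 1) r \<theta>) * cis \<theta>) (at r within A)"
proof -
  define E where "E = exp (w / 2 * (complex_of_real r * cis \<theta>))"
  have 1: "((\<lambda>r. r powr (- s)) has_real_derivative - s * r powr (- s - 1)) (at r within A)"
    using assms by (auto intro!: derivative_eq_intros)
  have 2: "((\<lambda>z. exp (w / 2 * (z * cis \<theta>))) has_field_derivative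
      (w / 2 * cis \<theta> * exp (w / 2 * (z * cis \<theta>)))) (at z)" for z
    by (auto intro!: derivative_eq_intros)
  have 3: "((\<lambda>r. complex_of_real (r powr (- s)) * cis (- s * \<theta>) * exp (w / 2 * (complex_of_real r * cis \<theta>)))
    has_vector_derivative
      (complex_of_real (r powr (- s)) * cis (- s * \<theta>) * (w / 2 * cis \<theta> * E) +
       complex_of_real (- s * r powr (- s - 1)) * cis (- s * \<theta>) * E))
    (at r within A)"
    unfolding E_def
    by (rule has_vector_derivative_mult has_vector_derivative_mult_left has_vector_derivative_of_real 1
        has_vector_derivative_real_field[THEN has_vector_derivative_at_within] 2)+
  define D where "D = cis (- (s + 1) * \<theta>)"
  have D: "cis (- s * \<theta>) = D * cis \<theta>"
    by (simp add: D_def cis_mult algebra_simps)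
  have e: "- s - 1 = - (s + 1)" by simp
  have 4: "complex_of_real (r powr (- s)) * cis (- s * \<theta>) * (w / 2 * cis \<theta> * E) +
       complex_of_real (- s * r powr (- s - 1)) * cis (- s * \<theta>) * E =
     (w / 2 * (complex_of_real (r powr (- s)) * cis (- s * \<theta>) * E) -
       s * (complex_of_real (r powr (- (s + 1))) * cis (- (s + 1) * \<theta>) * E)) * cis \<theta>"
    unfolding D D_def[symmetric] e by (simp add: algebra_simps)
  show ?thesis
    using 3[unfolded 4] by (simp only: exp_kernel_def polar_pow_def rcis_def E_def)
qed

text \<open>The same complex derivative, now times dz/d\<theta> = i z.\<close>

lemma has_vector_derivative_exp_kernel_circle:
  assumes "r > 0"
  shows "((\<lambda>\<theta>. exp_kernel w s r \<theta>) has_vector_derivative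
    (w / 2 * exp_kernel w s r \<theta> - s * exp_kernel w (s + 1) r \<theta>) * (\<i> * rcis r \<theta>)) (at \<theta> within A)"
proof -
  define E where "E = exp (w / 2 * rcis r \<theta>)"
  define P where "P = rcis (r powr (- s)) (- s * \<theta>)"
  have 1: "((\<lambda>\<theta>. rcis (r powr (- s)) (- s * \<theta>)) has_vector_derivative - s * \<i> * P) (at \<theta> within A)"
    unfolding rcis_def P_def has_vector_derivative_def
    by (auto intro!: derivative_eq_intros simp: scaleR_conv_of_real)
  have 2: "((\<lambda>\<theta>. exp (w / 2 * rcis r \<theta>)) has_vector_derivative w / 2 * \<i> * rcis r \<theta> * E) (at \<theta> within A)"
  proof -
    have "((\<lambda>\<theta>. w / 2 * rcis r \<theta>) has_vector_derivative w / 2 * \<i> * rcis r \<theta>) (at \<theta> within A)"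
      unfolding rcis_def has_vector_derivative_def
      by (auto intro!: derivative_eq_intros simp: scaleR_conv_of_real)
    from field_vector_diff_chain_within[OF this DERIV_subset[OF DERIV_exp subset_UNIV]]
    show ?thesis by (simp add: o_def E_def)
  qed
  have 3: "((\<lambda>\<theta>. exp_kernel w s r \<theta>) has_vector_derivative
      P * (w / 2 * \<i> * rcis r \<theta> * E) + - s * \<i> * P * E) (at \<theta> within A)"
    unfolding exp_kernel_def polar_pow_def
    using has_vector_derivative_mult[OF 1 2] by (simp add: E_def P_def)
  have 4: "exp_kernel w s r \<theta> = P * E"
    by (simp add: exp_kernel_def polar_pow_def E_def P_def)
  have "(w / 2 * exp_kernel w s r \<theta> - s * exp_kernel w (s + 1) r \<theta>) * (\<i> * rcis r \<theta>) =
      w / 2 * exp_kernel w s r \<theta> * (\<i> * rcis r \<theta>) - s * \<i> * (exp_kernel w (s + 1) r \<theta> * rcis r \<theta>)"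
    by (simp add: algebra_simps)
  also have "\<dots> = P * (w / 2 * \<i> * rcis r \<theta> * E) + - s * \<i> * P * E"
    unfolding exp_kernel_Suc[OF assms] 4 by (simp add: algebra_simps)
  finally show ?thesis
    using 3 by simp
qed

text \<open>The combined integrand is the derivative of the kernel along the ray; the kernel tends
  to 0 at infinity, so only the finite end contributes.\<close>

lemma integral_exp_kernel_ray_FTC:
  assumes w: "w / 2 * cis \<theta> = - complex_of_real c" and "c > 0" "\<rho> > 0" "s \<ge> 0"
  shows "w / 2 * integral {\<rho>..} (\<lambda>r. exp_kernel w s r \<theta> * cis \<theta>) -
      s * integral {\<rho>..} (\<lambda>r. exp_kernel w (s + 1) r \<theta> * cis \<theta>) = - exp_kernel w s \<rho> \<theta>"
proof -
  have abs: "(\<lambda>r. exp_kernel w s r \<theta> * C) absolutely_integrable_on {\<rho>..}"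
    "(\<lambda>r. exp_kernel w (s + 1) r \<theta> * C) absolutely_integrable_on {\<rho>..}" for C
    using assms by (intro absolutely_integrable_exp_kernel_ray[OF w]; simp)+
  have int: "(\<lambda>r. exp_kernel w s r \<theta> * C) integrable_on {\<rho>..}"
    "(\<lambda>r. exp_kernel w (s + 1) r \<theta> * C) integrable_on {\<rho>..}" for C
    using abs by (simp_all add: absolutely_integrable_on_def)
  have "((\<lambda>r. exp_kernel w s r \<theta>) \<longlongrightarrow> 0) at_top"
  proof (rule Lim_null_comparison)
    have "filterlim (\<lambda>r. c * r) at_top at_top"
      using \<open>c > 0\<close> by (intro filterlim_tendsto_pos_mult_at_top[OF tendsto_const] filterlim_ident)
    then show "((\<lambda>r. exp (- (c * r))) \<longlongrightarrow> 0) at_top"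
      by (intro filterlim_compose[OF exp_at_bot]) (simp add: filterlim_uminus_at_bot)
    show "\<forall>\<^sub>F r in at_top. norm (exp_kernel w s r \<theta>) \<le> exp (- (c * r))"
      using eventually_ge_at_top[of 1]
    proof eventually_elim
      case (elim r)
      then have "r powr (- s) \<le> 1"
        using powr_mono[of "- s" 0 r] \<open>s \<ge> 0\<close> by simp
      then show ?case
        by (simp add: exp_kernel_ray[OF w] norm_mult)
    qed
  qed
  moreover have "(\<lambda>r. (w / 2 * exp_kernel w s r \<theta> - s * exp_kernel w (s + 1) r \<theta>) * cis \<theta>)
      absolutely_integrable_on {\<rho>..}"
  proof -
    have "(\<lambda>r. exp_kernel w s r \<theta> * (w / 2 * cis \<theta>) - exp_kernel w (s + 1) r \<theta> * (s * cis \<theta>))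
        absolutely_integrable_on {\<rho>..}"
      using abs by (rule set_integral_diff)
    then show ?thesis by (simp add: algebra_simps)
  qed
  ultimately have "integral {\<rho>..} (\<lambda>r. (w / 2 * exp_kernel w s r \<theta> - s * exp_kernel w (s + 1) r \<theta>) * cis \<theta>)
      = 0 - exp_kernel w s \<rho> \<theta>"
    using \<open>\<rho> > 0\<close> by (intro integral_atLeast_FTC has_vector_derivative_exp_kernel_ray) auto
  moreover have "integral {\<rho>..} (\<lambda>r. (w / 2 * exp_kernel w s r \<theta> - s * exp_kernel w (s + 1) r \<theta>) * cis \<theta>) =
      integral {\<rho>..} (\<lambda>r. w / 2 * (exp_kernel w s r \<theta> * cis \<theta>) - s * (exp_kernel w (s + 1) r \<theta> * cis \<theta>))"
    by (simp add: algebra_simps)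
  moreover have "\<dots> = w / 2 * integral {\<rho>..} (\<lambda>r. exp_kernel w s r \<theta> * cis \<theta>) -
      s * integral {\<rho>..} (\<lambda>r. exp_kernel w (s + 1) r \<theta> * cis \<theta>)"
    by (subst Henstock_Kurzweil_Integration.integral_diff)
      (intro integrable_on_mult_right int | simp only: integral_mult_right)+
  ultimately show ?thesis by simp
qed

text \<open>The derivative of the kernel integrates to 0 over the contour: the kernel vanishes at
  both infinite ends, and its values at the two points where circle and rays meet cancel between
  neighbouring pieces.\<close>

lemma hankel_integral_exp_kernel_Suc:
  assumes w: "w \<noteq> 0" "w = rcis (norm w) \<alpha>" and "\<epsilon> > -1" "s \<ge> 0"
  shows "w / 2 * hankel_integral (exp_kernel w s) \<epsilon> \<alpha> = s * hankel_integral (exp_kernel w (s + 1)) \<epsilon> \<alpha>"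
proof -
  let ?k = "exp_kernel w s" and ?k' = "exp_kernel w (s + 1)"
  let ?a = "- \<alpha> - pi" and ?b = "- \<alpha> + pi" and ?d = "\<lambda>\<theta>. \<i> * rcis (1 + \<epsilon>) \<theta>"
  have \<rho>: "1 + \<epsilon> > 0" and c: "norm w / 2 > 0" using assms by auto
  note ray = integral_exp_kernel_ray_FTC[OF _ c \<rho> \<open>s \<ge> 0\<close>]
  have int: "(\<lambda>\<theta>. exp_kernel w u (1 + \<epsilon>) \<theta> * ?d \<theta>) integrable_on {?a..?b}" for u
    by (intro integrable_continuous_interval continuous_intros continuous_on_exp_kernel_circle)
  have "integral {?a..?b} (\<lambda>\<theta>. (w / 2 * ?k (1 + \<epsilon>) \<theta> - s * ?k' (1 + \<epsilon>) \<theta>) * ?d \<theta>) =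
      ?k (1 + \<epsilon>) ?b - ?k (1 + \<epsilon>) ?a"
    by (intro integral_unique fundamental_theorem_of_calculus
        has_vector_derivative_exp_kernel_circle[OF \<rho>]) simp
  moreover have "integral {?a..?b} (\<lambda>\<theta>. (w / 2 * ?k (1 + \<epsilon>) \<theta> - s * ?k' (1 + \<epsilon>) \<theta>) * ?d \<theta>) =
      integral {?a..?b} (\<lambda>\<theta>. w / 2 * (?k (1 + \<epsilon>) \<theta> * ?d \<theta>) - s * (?k' (1 + \<epsilon>) \<theta> * ?d \<theta>))"
    by (simp add: algebra_simps)
  moreover have "\<dots> = w / 2 * integral {?a..?b} (\<lambda>\<theta>. ?k (1 + \<epsilon>) \<theta> * ?d \<theta>) -
      s * integral {?a..?b} (\<lambda>\<theta>. ?k' (1 + \<epsilon>) \<theta> * ?d \<theta>)"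
    by (subst Henstock_Kurzweil_Integration.integral_diff)
      (intro integrable_on_mult_right int | simp only: integral_mult_right)+
  ultimately have "w / 2 * integral {?a..?b} (\<lambda>\<theta>. ?k (1 + \<epsilon>) \<theta> * ?d \<theta>) -
      s * integral {?a..?b} (\<lambda>\<theta>. ?k' (1 + \<epsilon>) \<theta> * ?d \<theta>) = ?k (1 + \<epsilon>) ?b - ?k (1 + \<epsilon>) ?a"
    by simp
  \<comment> \<open>Here \<open>p\<close> and \<open>q\<close> are the kernel values at the start
    and the end of the circle; the incoming ray counts negatively.\<close>
  moreover have "- x1 + x2 + x3 = - y1 + y2 + y3"
    if "x1 - y1 = - p" "x3 - y3 = - q" "x2 - y2 = q - p" for x1 x2 x3 y1 y2 y3 p q :: complex
    using that by (auto simp: diff_eq_eq)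
  ultimately show ?thesis
    using ray[OF cis_ray(1)[OF w(2)]] ray[OF cis_ray(2)[OF w(2)]]
    unfolding hankel_integral_def distrib_left mult_minus_right by blast
qed

section \<open>Hankel's formula for 1 / Gamma\<close>

lemma rcis_powr:
  assumes "c > 0" "- pi < \<alpha>" "\<alpha> \<le> pi"
  shows "rcis c \<alpha> powr complex_of_real u = complex_of_real (c powr u) * cis (u * \<alpha>)"
proof -
  \<comment> \<open>The range of \<open>\<alpha>\<close> makes this the principal logarithm.\<close>
  have "Ln (rcis c \<alpha>) = complex_of_real (ln c) + \<i> * complex_of_real \<alpha>"
    using assms by (intro Ln_unique) (simp_all add: exp_add exp_of_real rcis_def cis_conv_exp)
  moreover have "rcis c \<alpha> \<noteq> 0" using assms by simp
  ultimately show ?thesis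
    using assms
    by (simp add: powr_def distrib_left exp_add cis_conv_exp mult_ac flip: exp_of_real)
qed

lemma hankel_integral_exp_kernel_base:
  assumes w: "w \<noteq> 0" "w = rcis (norm w) \<alpha>" "- pi < \<alpha>" "\<alpha> \<le> pi" and \<epsilon>: "\<epsilon> > -1" and s: "0 < s" "s \<le> 1"
  shows "hankel_integral (exp_kernel w s) \<epsilon> \<alpha> =
    2 * pi * \<i> * (w / 2) powr complex_of_real (s - 1) * rGamma (complex_of_real s)"
proof -
  define c \<rho> a b where "c = norm w / 2" and "\<rho> = 1 + \<epsilon>" and "a = - \<alpha> - pi" and "b = - \<alpha> + pi"
  \<comment> \<open>On a ray, z^(-s) dz is r^(-s) times the phase
    \<open>cis ((1 - s) * \<theta>)\<close> times dr. So \<open>D\<close> is the jump of the phase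
    from the incoming to the outgoing ray, and \<open>h r * D\<close> is the joint integrand of
    both.\<close>
  define D where "D = cis ((1 - s) * b) - cis ((1 - s) * a)"
  define h where "h = (\<lambda>r. r powr (- s) * exp (- (c * r)))"
  \<comment> \<open>On the circle, z^(-s) exp(w z / 2) dz is i R^(1 - s) \<open>E R \<theta>\<close>
    d\<theta>, so that \<open>\<Phi> R\<close> below is the contribution of the circle of radius
    \<open>R\<close>; \<open>E'\<close> is the derivative of \<open>E\<close> in
    \<open>R\<close>.\<close>
  define E where "E = (\<lambda>R \<theta>. exp (w / 2 * rcis R \<theta>) * cis ((1 - s) * \<theta>))"
  define E' where "E' = (\<lambda>R \<theta>. w / 2 * cis \<theta> * E R \<theta>)"
  define G where "G = (\<lambda>R. integral {a..b} (E R))"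
  \<comment> \<open>For s = 1 the value at R = 0 has to be 1, whereas \<open>0 powr 0\<close> is 0;
    the case distinction keeps \<open>\<Phi>\<close> continuous at 0.\<close>
  define P where "P = (\<lambda>R. if s = 1 then 1 else R powr (1 - s))"
  define \<Phi> where "\<Phi> = (\<lambda>R. \<i> * (complex_of_real (P R) * G R))"
  have c: "c > 0" and \<rho>: "\<rho> > 0" and ab: "a \<le> b"
    using w \<epsilon> by (simp_all add: c_def \<rho>_def a_def b_def)
  have ray_a: "w / 2 * cis a = - complex_of_real c" and ray_b: "w / 2 * cis b = - complex_of_real c"
    using cis_ray[OF w(2)] by (simp_all add: a_def b_def c_def)
  have E_ab: "E R a = complex_of_real (exp (- (c * R))) * cis ((1 - s) * a)"
    "E R b = complex_of_real (exp (- (c * R))) * cis ((1 - s) * b)" for R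
    unfolding E_def mult_rcis_ray[OF ray_a] mult_rcis_ray[OF ray_b] exp_of_real by simp_all
  have cont_E: "continuous_on {a..b} (E R)" for R
    unfolding E_def by (intro continuous_intros)
  have cont_E': "continuous_on {a..b} (E' R)" for R
    unfolding E'_def E_def by (intro continuous_intros)
  have dG: "(G has_vector_derivative integral {a..b} (E' R)) (at R)" for R
  proof -
    have "((\<lambda>R. integral (cbox a b) (E R)) has_vector_derivative integral (cbox a b) (E' R)) (at R within UNIV)"
    proof (rule leibniz_rule_vector_derivative)
      fix R \<theta> :: real
      have "((\<lambda>R. w / 2 * rcis R \<theta>) has_vector_derivative w / 2 * cis \<theta>) (at R)"
        unfolding rcis_def has_vector_derivative_def
        by (auto intro!: derivative_eq_intros simp: scaleR_conv_of_real)
      from field_vector_diff_chain_within[OF this DERIV_subset[OF DERIV_exp subset_UNIV]]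
      have "((\<lambda>R. exp (w / 2 * rcis R \<theta>)) has_vector_derivative w / 2 * cis \<theta> * exp (w / 2 * rcis R \<theta>)) (at R)"
        by (simp add: o_def)
      from has_vector_derivative_mult_left[OF this, of "cis ((1 - s) * \<theta>)"]
      show "((\<lambda>R. E R \<theta>) has_vector_derivative E' R \<theta>) (at R within UNIV)"
        by (simp add: E_def E'_def mult.assoc)
    next
      show "E R integrable_on cbox a b" for R
        using cont_E by (simp add: integrable_continuous_interval)
      show "continuous_on (UNIV \<times> cbox a b) (\<lambda>(R, \<theta>). E' R \<theta>)"
        unfolding E'_def E_def rcis_def case_prod_unfold by (intro continuous_intros)
    qed auto
    then show ?thesis by (simp add: G_def)
  qed
  \<comment> \<open>The left-hand side is the integral of the angular derivative of
    \<open>E R\<close>; at both ends of the circle w z / 2 equals - c R.\<close>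
  have ftc: "\<i> * ((1 - s) * G R + R * integral {a..b} (E' R)) = exp (- (c * R)) * D" for R
  proof -
    have "((\<lambda>\<theta>. E R \<theta>) has_vector_derivative \<i> * ((1 - s) * E R \<theta> + R * E' R \<theta>)) (at \<theta> within {a..b})" for \<theta>
    proof -
      have 1: "((\<lambda>\<theta>. cis ((1 - s) * \<theta>)) has_vector_derivative \<i> * (1 - s) * cis ((1 - s) * \<theta>)) (at \<theta> within {a..b})"
        unfolding has_vector_derivative_def
        by (auto intro!: derivative_eq_intros simp: scaleR_conv_of_real)
      have "((\<lambda>\<theta>. w / 2 * rcis R \<theta>) has_vector_derivative w / 2 * \<i> * rcis R \<theta>) (at \<theta> within {a..b})"
        unfolding rcis_def has_vector_derivative_def
        by (auto intro!: derivative_eq_intros simp: scaleR_conv_of_real)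
      from field_vector_diff_chain_within[OF this DERIV_subset[OF DERIV_exp subset_UNIV]]
      have 2: "((\<lambda>\<theta>. exp (w / 2 * rcis R \<theta>)) has_vector_derivative
          w / 2 * \<i> * rcis R \<theta> * exp (w / 2 * rcis R \<theta>)) (at \<theta> within {a..b})"
        by (simp add: o_def)
      show ?thesis
        using has_vector_derivative_mult[OF 2 1] by (simp add: E_def E'_def rcis_def algebra_simps)
    qed
    then have "((\<lambda>\<theta>. \<i> * ((1 - s) * E R \<theta> + R * E' R \<theta>)) has_integral E R b - E R a) {a..b}"
      by (intro fundamental_theorem_of_calculus ab)
    moreover have "((\<lambda>\<theta>. \<i> * ((1 - s) * E R \<theta> + R * E' R \<theta>)) has_integral
        \<i> * ((1 - s) * G R + R * integral {a..b} (E' R))) {a..b}"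
      unfolding G_def
      by (intro has_integral_mult_right has_integral_add integrable_integral integrable_continuous_interval
          cont_E cont_E')
    ultimately show ?thesis
      by (auto dest: has_integral_unique simp: E_ab D_def algebra_simps)
  qed
  \<comment> \<open>Enlarging the circle changes its contribution by exactly what the rays
    lose.\<close>
  have d\<Phi>: "(\<Phi> has_vector_derivative complex_of_real (h R) * D) (at R)" if "R > 0" for R
  proof -
    have dP: "(P has_real_derivative (1 - s) * R powr (- s)) (at R)"
      using that by (cases "s = 1") (auto simp: P_def intro!: derivative_eq_intros)
    have P: "P R = R powr (- s) * R"
      using that powr_add[of R "- s" 1] by (auto simp: P_def powr_minus)
    have "(\<Phi> has_vector_derivative \<i> * (complex_of_real (P R) * integral {a..b} (E' R) +
        complex_of_real ((1 - s) * R powr (- s)) * G R)) (at R)"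
      unfolding \<Phi>_def
      by (intro has_vector_derivative_mult_right has_vector_derivative_mult dG
          has_vector_derivative_of_real dP)
    also have "\<i> * (complex_of_real (P R) * integral {a..b} (E' R) +
        complex_of_real ((1 - s) * R powr (- s)) * G R) =
        complex_of_real (R powr (- s)) * (\<i> * ((1 - s) * G R + R * integral {a..b} (E' R)))"
      unfolding P by (simp add: algebra_simps)
    also have "\<dots> = complex_of_real (h R) * D"
      unfolding ftc by (simp add: h_def)
    finally show ?thesis .
  qed
  \<comment> \<open>Here s <= 1 enters: R^(1 - s) has a finite limit at 0. The fundamental theorem
    then applies down to radius 0, with derivatives in the interior only.\<close>
  have "continuous_on {0..\<rho>} P"
  proof (cases "s = 1")
    case False
    then have "continuous_on {0..\<rho>} (\<lambda>R. R powr (1 - s))"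
      using s by (intro continuous_on_powr' continuous_intros) auto
    with False show ?thesis by (simp add: P_def)
  qed (simp add: P_def)
  moreover have "continuous_on {0..\<rho>} G"
    using dG by (meson continuous_at_imp_continuous_on has_vector_derivative_continuous)
  ultimately have "continuous_on {0..\<rho>} \<Phi>"
    unfolding \<Phi>_def by (intro continuous_intros)
  then have near: "((\<lambda>R. complex_of_real (h R) * D) has_integral \<Phi> \<rho> - \<Phi> 0) {0..\<rho>}"
    using \<rho> d\<Phi> by (intro fundamental_theorem_of_calculus_interior) auto
  have circle: "integral {a..b} (\<lambda>\<theta>. exp_kernel w s \<rho> \<theta> * (\<i> * rcis \<rho> \<theta>)) = \<Phi> \<rho>"
  proof -
    have *: "exp_kernel w s \<rho> \<theta> * (\<i> * rcis \<rho> \<theta>) = \<i> * (complex_of_real (P \<rho>) * E \<rho> \<theta>)" for \<theta>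
    proof -
      have "exp_kernel w s \<rho> \<theta> * rcis \<rho> \<theta> = polar_pow \<rho> \<theta> (- s + 1) * exp (w / 2 * rcis \<rho> \<theta>)"
        unfolding polar_pow_add polar_pow_1[OF \<rho>] by (simp add: exp_kernel_def)
      also have "polar_pow \<rho> \<theta> (- s + 1) = complex_of_real (P \<rho>) * cis ((1 - s) * \<theta>)"
        using \<rho> by (auto simp: polar_pow_def P_def rcis_def)
      finally show ?thesis by (simp add: E_def algebra_simps)
    qed
    show ?thesis unfolding * \<Phi>_def G_def by simp
  qed
  have ray: "((\<lambda>r. complex_of_real (h r) * C) absolutely_integrable_on {\<rho>..}) \<and>
     exp_kernel w s r \<theta> * cis \<theta> = complex_of_real (h r) * cis ((1 - s) * \<theta>)"
    if "w / 2 * cis \<theta> = - complex_of_real c" for \<theta> C r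
  proof
    have *: "exp_kernel w s r \<theta> * K = complex_of_real (h r) * (cis (- s * \<theta>) * K)" for r K
      by (simp add: exp_kernel_ray[OF that] h_def)
    show "(\<lambda>r. complex_of_real (h r) * C) absolutely_integrable_on {\<rho>..}"
      using absolutely_integrable_exp_kernel_ray[OF that c \<rho> less_imp_le[OF s(1)], of "cis (s * \<theta>) * C"]
      unfolding * by (simp add: mult.assoc[symmetric] cis_mult)
    show "exp_kernel w s r \<theta> * cis \<theta> = complex_of_real (h r) * cis ((1 - s) * \<theta>)"
      unfolding * by (simp add: cis_mult algebra_simps)
  qed
  have int_h: "(\<lambda>r. complex_of_real (h r) * C) integrable_on {\<rho>..}" for C
    using ray[OF ray_a] by (simp add: absolutely_integrable_on_def)
  have hankel: "hankel_integral (exp_kernel w s) \<epsilon> \<alpha> = \<Phi> \<rho> + integral {\<rho>..} (\<lambda>r. complex_of_real (h r) * D)"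
  proof -
    have "integral {\<rho>..} (\<lambda>r. complex_of_real (h r) * D) =
        integral {\<rho>..} (\<lambda>r. complex_of_real (h r) * cis ((1 - s) * b)) -
        integral {\<rho>..} (\<lambda>r. complex_of_real (h r) * cis ((1 - s) * a))"
      unfolding D_def right_diff_distrib
      by (intro Henstock_Kurzweil_Integration.integral_diff int_h)
    then show ?thesis
      using circle ray[OF ray_a] ray[OF ray_b]
      by (simp add: hankel_integral_def a_def b_def \<rho>_def)
  qed
  have base: "(w / 2) powr complex_of_real (s - 1) = complex_of_real (c powr (s - 1)) * cis ((s - 1) * \<alpha>)"
  proof -
    have "w / 2 = rcis c \<alpha>"
      by (subst w(2)) (simp add: c_def rcis_def)
    then show ?thesis
      using rcis_powr[OF c w(3,4), of "s - 1"] by simp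
  qed
  \<comment> \<open>The two phases are \<open>cis ((s - 1) * \<alpha>)\<close> turned by the
    opposite angles (1 - s) pi and -(1 - s) pi, and sin(pi - pi s) = sin(pi s).\<close>
  have D: "D = 2 * \<i> * sin (pi * s) * cis ((s - 1) * \<alpha>)"
  proof -
    have "D = cis ((s - 1) * \<alpha>) * (cis ((1 - s) * pi) - cis (- ((1 - s) * pi)))"
      by (simp add: D_def a_def b_def right_diff_distrib cis_mult algebra_simps)
    also have "cis ((1 - s) * pi) - cis (- ((1 - s) * pi)) = 2 * \<i> * sin (pi - pi * s)"
      by (simp add: complex_eq_iff algebra_simps)
    finally show ?thesis by (simp add: sin_diff)
  qed
  show ?thesis
  proof (cases "s = 1")
    case True
    \<comment> \<open>For s = 1 there is no jump: \<open>\<Phi>\<close> is constant, and its value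
      at 0 is the integral of i over an angle of 2 pi.\<close>
    then have "D = 0" by (simp add: D_def)
    with near have "\<Phi> \<rho> = \<Phi> 0"
      by (auto dest: has_integral_unique[OF has_integral_0])
    also have "\<dots> = 2 * pi * \<i>"
      using True by (simp add: \<Phi>_def P_def G_def E_def a_def b_def scaleR_conv_of_real)
    finally show ?thesis
      unfolding hankel using True w(1) \<open>D = 0\<close> by simp
  next
    case False
    with s have s1: "s < 1" by simp
    \<comment> \<open>For s < 1 the circle disappears in the limit, and \<open>\<Phi> \<rho>\<close>
      becomes the missing part of the ray integral, from 0 to \<open>\<rho>\<close>.\<close>
    have "\<Phi> 0 = 0" using False by (simp add: \<Phi>_def P_def)
    have "((\<lambda>R. complex_of_real (h R) * D) has_integral
        (\<Phi> \<rho> - \<Phi> 0) + integral {\<rho>..} (\<lambda>r. complex_of_real (h r) * D)) ({0..\<rho>} \<union> {\<rho>..})"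
    proof (intro has_integral_Un near integrable_integral int_h)
      have "{0..\<rho>} \<inter> {\<rho>..} = {\<rho>}" using \<rho> by auto
      then show "negligible ({0..\<rho>} \<inter> {\<rho>..})" by simp
    qed
    also have "{0..\<rho>} \<union> {\<rho>..} = {0..}" using \<rho> by auto
    finally have "hankel_integral (exp_kernel w s) \<epsilon> \<alpha> = integral {0..} (\<lambda>R. complex_of_real (h R) * D)"
      unfolding hankel \<open>\<Phi> 0 = 0\<close> diff_zero by (rule integral_unique[symmetric])
    also have "\<dots> = complex_of_real (Gamma (1 - s) * c powr (s - 1)) * D"
      using integral_Gamma_scaled[OF c s1] unfolding h_def
      by (intro integral_unique has_integral_mult_left has_integral_of_real)
    also have "\<dots> = 2 * \<i> * (complex_of_real (sin (pi * s) * Gamma (1 - s)) * (w / 2) powr complex_of_real (s - 1))"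
      unfolding D base by (simp add: mult_ac)
    \<comment> \<open>The reflection formula rGamma(s) rGamma(1 - s) = sin(pi s) / pi, multiplied by
      Gamma(1 - s).\<close>
    also have "complex_of_real (sin (pi * s) * Gamma (1 - s)) = pi * rGamma (complex_of_real s)"
    proof -
      define u v g where "u = rGamma (complex_of_real s)" and "v = rGamma (1 - complex_of_real s)"
        and "g = complex_of_real (Gamma (1 - s))"
      have "u * v = complex_of_real (sin (pi * s)) / pi"
        using rGamma_reflection_complex[of s] by (simp add: u_def v_def flip: sin_of_real)
      then have "complex_of_real (sin (pi * s)) * g = pi * u * (g * v)"
        by simp
      also have "g * v = 1"
      proof -
        have "Gamma (1 - s) > 0" using s1 by (intro Gamma_real_pos) simp
        then have "Gamma (1 - s) * rGamma (1 - s) = 1"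
          by (simp add: rGamma_inverse_Gamma)
        then have "complex_of_real (Gamma (1 - s) * rGamma (1 - s)) = 1" by simp
        then show ?thesis by (simp add: g_def v_def flip: rGamma_complex_of_real)
      qed
      finally show ?thesis by (simp add: u_def g_def)
    qed
    finally show ?thesis by (simp add: mult_ac)
  qed
qed

text \<open>Induction on n for s = u + n with 0 < u <= 1: integration by parts multiplies by w / 2
  and divides by v, which is how the power of w / 2 and rGamma change from v to v + 1.\<close>

lemma hankel_integral_exp_kernel:
  assumes w: "w \<noteq> 0" "w = rcis (norm w) \<alpha>" "- pi < \<alpha>" "\<alpha> \<le> pi" and \<epsilon>: "\<epsilon> > -1" and s: "s > 0"
  shows "hankel_integral (exp_kernel w s) \<epsilon> \<alpha> =
    2 * pi * \<i> * (w / 2) powr complex_of_real (s - 1) * rGamma (complex_of_real s)"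
proof -
  have "hankel_integral (exp_kernel w (u + real n)) \<epsilon> \<alpha> =
    2 * pi * \<i> * (w / 2) powr complex_of_real (u + real n - 1) * rGamma (complex_of_real (u + real n))"
    if u: "0 < u" "u \<le> 1" for u n
  proof (induction n)
    case 0
    then show ?case using hankel_integral_exp_kernel_base[OF w \<epsilon> u] by simp
  next
    case (Suc n)
    define v where "v = u + real n"
    have v: "v > 0" using u by (simp add: v_def add_pos_nonneg)
    have "v * hankel_integral (exp_kernel w (v + 1)) \<epsilon> \<alpha> =
        w / 2 * (2 * pi * \<i> * (w / 2) powr complex_of_real (v - 1) * rGamma (complex_of_real v))"
      using hankel_integral_exp_kernel_Suc[OF w(1,2) \<epsilon>, of v] v Suc.IH by (simp add: v_def)
    also have "rGamma (complex_of_real v) = v * rGamma (complex_of_real (v + 1))"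
      using rGamma_plus1[of "complex_of_real v"] by simp
    also have "w / 2 * (2 * pi * \<i> * (w / 2) powr complex_of_real (v - 1) * (v * rGamma (complex_of_real (v + 1)))) =
       v * (2 * pi * \<i> * ((w / 2) powr complex_of_real (v - 1) * (w / 2)) * rGamma (complex_of_real (v + 1)))"
      by (simp add: mult_ac)
    also have "(w / 2) powr complex_of_real (v - 1) * (w / 2) = (w / 2) powr complex_of_real v"
      using powr_add[of "w / 2" "complex_of_real (v - 1)" 1] w(1) by simp
    finally have "hankel_integral (exp_kernel w (v + 1)) \<epsilon> \<alpha> =
        2 * pi * \<i> * (w / 2) powr complex_of_real v * rGamma (complex_of_real (v + 1))"
      using v by simp
    then show ?case by (simp add: v_def add_ac)
  qed
  \<comment> \<open>The number \<open>\<lceil>s\<rceil> - 1\<close> is the natural n with 0 < s - n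
    <= 1; the floor of s would leave 0 at integers.\<close>
  from this[of "s - real (nat (\<lceil>s\<rceil> - 1))" "nat (\<lceil>s\<rceil> - 1)"] s show ?thesis
    by (simp add: of_nat_nat) linarith
qed

subsection \<open>Termwise integration\<close>

text \<open>Dominated convergence for the partial sums, with the total of the
  \<open>\<bar>a n\<bar>\<close> times \<open>h\<close> as common bound.\<close>

lemma integral_sums_dominated:
  fixes F :: "nat \<Rightarrow> real \<Rightarrow> complex" and h :: "real \<Rightarrow> real"
  assumes F: "\<And>n. F n integrable_on S" and h: "h integrable_on S" and a: "summable a"
    and le: "\<And>n x. x \<in> S \<Longrightarrow> norm (F n x) \<le> a n * h x" and h0: "\<And>x. x \<in> S \<Longrightarrow> 0 \<le> h x"
    and sums: "\<And>x. x \<in> S \<Longrightarrow> (\<lambda>n. F n x) sums G x"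
  shows "G integrable_on S" and "(\<lambda>n. integral S (F n)) sums integral S G"
proof -
  have int: "(\<lambda>x. \<Sum>i<n. F i x) integrable_on S" for n
    using F by (intro integrable_sum) auto
  \<comment> \<open>Where \<open>h\<close> vanishes, so do all terms; where it is positive, the
    estimate itself forces \<open>a n\<close> to be nonnegative, and partial sums stay below the
    total.\<close>
  have bound: "norm (\<Sum>i<n. F i x) \<le> (\<Sum>n. \<bar>a n\<bar>) * h x" if x: "x \<in> S" for n x
  proof (cases "h x = 0")
    case True
    then have "F i x = 0" for i using le[OF x, of i] by simp
    then show ?thesis using True by simp
  next
    case False
    with h0[OF x] have hx: "h x > 0" by simp
    have a0: "0 \<le> a i" for i
      using order_trans[OF norm_ge_zero le[OF x, of i]] hx by (simp add: zero_le_mult_iff)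
    have "norm (\<Sum>i<n. F i x) \<le> (\<Sum>i<n. a i * h x)"
      by (intro sum_norm_le le x)
    also have "\<dots> \<le> (\<Sum>n. \<bar>a n\<bar>) * h x"
      using sum_le_suminf[OF a, of "{..<n}"] a0 hx by (simp flip: sum_distrib_right)
    finally show ?thesis .
  qed
  have hh: "(\<lambda>x. (\<Sum>n. \<bar>a n\<bar>) * h x) integrable_on S"
    using h by (rule integrable_on_mult_right)
  have lim: "(\<lambda>n. \<Sum>i<n. F i x) \<longlonglongrightarrow> G x" if "x \<in> S" for x
    using sums[OF that] by (simp add: sums_def)
  show "G integrable_on S"
    by (rule dominated_convergence(1)[OF int hh bound lim])
  have "(\<lambda>n. integral S (\<lambda>x. \<Sum>i<n. F i x)) \<longlonglongrightarrow> integral S G"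
    by (rule dominated_convergence(2)[OF int hh bound lim])
  moreover have "integral S (\<lambda>x. \<Sum>i<n. F i x) = (\<Sum>i<n. integral S (F i))" for n
    using F by (intro integral_sum) auto
  ultimately show "(\<lambda>n. integral S (F n)) sums integral S G"
    by (simp add: sums_def)
qed

text \<open>The majorant exp(Re(w z / 2)) equals exp(- |w| r / 2) on the rays, which is integrable
  at infinity, and is continuous on the circle.\<close>

lemma hankel_integral_sums:
  fixes F :: "nat \<Rightarrow> real \<Rightarrow> real \<Rightarrow> complex"
  assumes w: "w \<noteq> 0" "w = rcis (norm w) \<alpha>" and \<epsilon>: "\<epsilon> > -1"
    and F: "\<And>n. hankel_integrable (F n) \<epsilon> \<alpha>" and a: "summable a"
    and le: "\<And>n r \<theta>. r \<ge> 1 + \<epsilon> \<Longrightarrow> norm (F n r \<theta>) \<le> a n * exp (Re (w / 2 * rcis r \<theta>))"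
    and sums: "\<And>r \<theta>. r \<ge> 1 + \<epsilon> \<Longrightarrow> (\<lambda>n. F n r \<theta>) sums G r \<theta>"
  shows "hankel_integrable G \<epsilon> \<alpha>"
    and "(\<lambda>n. hankel_integral (F n) \<epsilon> \<alpha>) sums hankel_integral G \<epsilon> \<alpha>"
proof -
  have c: "norm w / 2 > 0" using w by simp
  have ray: "(\<lambda>r. G r \<theta> * cis \<theta>) integrable_on {1 + \<epsilon>..} \<and>
      (\<lambda>n. integral {1 + \<epsilon>..} (\<lambda>r. F n r \<theta> * cis \<theta>)) sums integral {1 + \<epsilon>..} (\<lambda>r. G r \<theta> * cis \<theta>)"
    if "w / 2 * cis \<theta> = - complex_of_real (norm w / 2)"
      and "\<And>n. (\<lambda>r. F n r \<theta> * cis \<theta>) integrable_on {1 + \<epsilon>..}" for \<theta>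
  proof -
    have 1: "(\<lambda>r. exp (- (norm w / 2) * r)) integrable_on {1 + \<epsilon>..}"
      using c by (rule integrable_on_exp_minus_to_infinity)
    have 2: "norm (F n r \<theta> * cis \<theta>) \<le> a n * exp (- (norm w / 2) * r)" if "r \<in> {1 + \<epsilon>..}" for n r
      using le[of r n \<theta>] that unfolding mult_rcis_ray[OF \<open>w / 2 * cis \<theta> = _\<close>]
      by (simp add: norm_mult)
    have 3: "(\<lambda>n. F n r \<theta> * cis \<theta>) sums (G r \<theta> * cis \<theta>)" if "r \<in> {1 + \<epsilon>..}" for r
      using sums[of r \<theta>] that by (intro sums_mult2) simp
    show ?thesis
      using integral_sums_dominated[OF that(2) 1 a 2 _ 3] by simp
  qed
  have circle: "(\<lambda>\<theta>. G (1 + \<epsilon>) \<theta> * (\<i> * rcis (1 + \<epsilon>) \<theta>)) integrable_on {- \<alpha> - pi..- \<alpha> + pi} \<and>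
      (\<lambda>n. integral {- \<alpha> - pi..- \<alpha> + pi} (\<lambda>\<theta>. F n (1 + \<epsilon>) \<theta> * (\<i> * rcis (1 + \<epsilon>) \<theta>))) sums
      integral {- \<alpha> - pi..- \<alpha> + pi} (\<lambda>\<theta>. G (1 + \<epsilon>) \<theta> * (\<i> * rcis (1 + \<epsilon>) \<theta>))"
  proof -
    \<comment> \<open>The factor \<open>1 + \<epsilon>\<close> is the modulus of
      dz/d\<theta>.\<close>
    let ?h = "\<lambda>\<theta>. exp (Re (w / 2 * rcis (1 + \<epsilon>) \<theta>)) * (1 + \<epsilon>)"
    have 0: "(\<lambda>\<theta>. F n (1 + \<epsilon>) \<theta> * (\<i> * rcis (1 + \<epsilon>) \<theta>)) integrable_on {- \<alpha> - pi..- \<alpha> + pi}" for n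
      using F by (simp add: hankel_integrable_def)
    have 1: "?h integrable_on {- \<alpha> - pi..- \<alpha> + pi}"
      by (intro integrable_continuous_interval continuous_intros)
    have 2: "norm (F n (1 + \<epsilon>) \<theta> * (\<i> * rcis (1 + \<epsilon>) \<theta>)) \<le> a n * ?h \<theta>" for n \<theta>
      using mult_right_mono[OF le[of "1 + \<epsilon>" n \<theta>], of "1 + \<epsilon>"] \<epsilon>
      by (simp add: norm_mult)
    have 3: "(\<lambda>n. F n (1 + \<epsilon>) \<theta> * (\<i> * rcis (1 + \<epsilon>) \<theta>)) sums
        (G (1 + \<epsilon>) \<theta> * (\<i> * rcis (1 + \<epsilon>) \<theta>))" for \<theta>
      using sums[of "1 + \<epsilon>" \<theta>] by (intro sums_mult2) simp
    show ?thesis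
      using integral_sums_dominated[OF 0 1 a 2 _ 3] \<epsilon> by simp
  qed
  have F': "(\<lambda>r. F n r (- \<alpha> - pi) * cis (- \<alpha> - pi)) integrable_on {1 + \<epsilon>..}"
    "(\<lambda>r. F n r (- \<alpha> + pi) * cis (- \<alpha> + pi)) integrable_on {1 + \<epsilon>..}" for n
    using F by (simp_all add: hankel_integrable_def)
  note ray' = ray[OF cis_ray(1)[OF w(2)] F'(1)] ray[OF cis_ray(2)[OF w(2)] F'(2)]
  show "hankel_integrable G \<epsilon> \<alpha>"
    using ray' circle by (simp add: hankel_integrable_def)
  show "(\<lambda>n. hankel_integral (F n) \<epsilon> \<alpha>) sums hankel_integral G \<epsilon> \<alpha>"
    unfolding hankel_integral_def using ray' circle
    by (intro sums_add sums_minus) auto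
qed

lemma hankel_integrable_cmult:
  "hankel_integrable F \<epsilon> \<alpha> \<Longrightarrow> hankel_integrable (\<lambda>r \<theta>. C * F r \<theta>) \<epsilon> \<alpha>"
  by (simp add: hankel_integrable_def mult.assoc integrable_on_mult_right)

lemma hankel_integral_cmult:
  "hankel_integral (\<lambda>r \<theta>. C * F r \<theta>) \<epsilon> \<alpha> = C * hankel_integral F \<epsilon> \<alpha>"
  unfolding hankel_integral_def mult.assoc integral_mult_right by (simp only: distrib_left mult_minus_right)

section \<open>Schlaefli's integral for the modified Bessel function\<close>

definition bessel_kernel :: "complex \<Rightarrow> real \<Rightarrow> real \<Rightarrow> real \<Rightarrow> complex" where
  "bessel_kernel w \<mu> r \<theta> =
     polar_pow r \<theta> (- \<mu>) * exp (w / 2 * (rcis r \<theta> + 1 / rcis r \<theta>)) / rcis r \<theta>"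

text \<open>The n-th term of exp(w / (2 z)) leaves (w/2)^n / n! times Hankel's integrand at s =
  \<mu> + n + 1, which is positive because \<mu> > -1. Hankel's formula contributes (w/2)^(\<mu> +
  n) / Gamma(\<mu> + n + 1), and the two powers (w/2)^n combine to the one in
  \<open>norm_bessel_I\<close>.\<close>

lemma hankel_integral_bessel_kernel:
  assumes w: "w \<noteq> 0" "w = rcis (norm w) \<alpha>" "- pi < \<alpha>" "\<alpha> \<le> pi" and \<epsilon>: "\<epsilon> > 0" and \<mu>: "\<mu> > -1"
  shows "hankel_integrable (bessel_kernel w \<mu>) \<epsilon> \<alpha>"
    and "hankel_integral (bessel_kernel w \<mu>) \<epsilon> \<alpha> =
      2 * pi * \<i> * (w / 2) powr complex_of_real \<mu> * norm_bessel_I \<mu> w"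
proof -
  define F where "F = (\<lambda>n r \<theta>. ((w / 2) ^ n / fact n) * exp_kernel w (\<mu> + real n + 1) r \<theta>)"
  have s: "\<mu> + real n + 1 > 0" for n
    using \<mu> by (simp add: add_pos_nonneg)
  have \<epsilon>': "\<epsilon> > -1" using \<epsilon> by simp
  have int: "hankel_integrable (F n) \<epsilon> \<alpha>" for n
    unfolding F_def using s[of n]
    by (intro hankel_integrable_cmult hankel_integrable_exp_kernel w \<epsilon>') simp
  have summ: "summable (\<lambda>n. norm ((w / 2) ^ n / fact n))"
  proof -
    have *: "x ^ n /\<^sub>R fact n = x ^ n / fact n" for x :: complex and n
      by (simp add: scaleR_conv_of_real divide_inverse)
    show ?thesis using summable_norm_exp[of "w / 2"] unfolding * .
  qed
  \<comment> \<open>Since \<epsilon> > 0, the contour stays outside the unit disc, so z^(-s) has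
    modulus at most 1 for every n.\<close>
  have le: "norm (F n r \<theta>) \<le> norm ((w / 2) ^ n / fact n) * exp (Re (w / 2 * rcis r \<theta>))"
    if "r \<ge> 1 + \<epsilon>" for n r \<theta>
  proof -
    have "r powr (- (\<mu> + real n + 1)) \<le> 1"
      using powr_mono[of "- (\<mu> + real n + 1)" 0 r] s[of n] that \<epsilon> by simp
    then have "norm (exp_kernel w (\<mu> + real n + 1) r \<theta>) \<le> exp (Re (w / 2 * rcis r \<theta>))"
      unfolding exp_kernel_def norm_mult norm_polar_pow norm_exp_eq_Re
      by (intro mult_left_le_one_le) simp_all
    then show ?thesis
      unfolding F_def norm_mult[of "(w / 2) ^ n / fact n"] by (intro mult_left_mono) simp_all
  qed
  have sums: "(\<lambda>n. F n r \<theta>) sums bessel_kernel w \<mu> r \<theta>" if "r \<ge> 1 + \<epsilon>" for r \<theta>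
  proof -
    have r: "r > 0" using that \<epsilon> by simp
    define z where "z = rcis r \<theta>"
    have z: "z \<noteq> 0" using r by (simp add: z_def)
    have pp: "polar_pow r \<theta> (- (\<mu> + real n + 1)) = polar_pow r \<theta> (- \<mu>) / (z ^ n * z)" for n
    proof -
      have "polar_pow r \<theta> (- (\<mu> + real n + 1)) =
          polar_pow r \<theta> (- \<mu>) * polar_pow r \<theta> (real n * - 1) * polar_pow r \<theta> (- 1)"
        by (simp flip: polar_pow_add)
      also have "\<dots> = polar_pow r \<theta> (- \<mu>) * inverse z ^ n * inverse z"
        unfolding polar_pow_of_nat_mult[OF r] polar_pow_minus[OF r] polar_pow_1[OF r] z_def ..
      finally show ?thesis by (simp add: divide_inverse power_inverse)
    qed
    have "(\<lambda>n. (w / (2 * z)) ^ n /\<^sub>R fact n) sums exp (w / (2 * z))"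
      by (rule exp_converges)
    then have "(\<lambda>n. polar_pow r \<theta> (- \<mu>) * exp (w / 2 * z) / z * ((w / (2 * z)) ^ n /\<^sub>R fact n)) sums
        (polar_pow r \<theta> (- \<mu>) * exp (w / 2 * z) / z * exp (w / (2 * z)))"
      by (rule sums_mult)
    moreover have "polar_pow r \<theta> (- \<mu>) * exp (w / 2 * z) / z * ((w / (2 * z)) ^ n /\<^sub>R fact n) = F n r \<theta>" for n
      using z unfolding F_def exp_kernel_def pp
      by (simp add: z_def[symmetric] scaleR_conv_of_real field_simps)
    moreover have "polar_pow r \<theta> (- \<mu>) * exp (w / 2 * z) / z * exp (w / (2 * z)) = bessel_kernel w \<mu> r \<theta>"
      unfolding bessel_kernel_def z_def[symmetric] by (simp add: distrib_left exp_add)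
    ultimately show ?thesis by simp
  qed
  show "hankel_integrable (bessel_kernel w \<mu>) \<epsilon> \<alpha>"
    by (rule hankel_integral_sums(1)[OF w(1,2) \<epsilon>' int summ le sums])
  define K where "K = 2 * pi * \<i> * (w / 2) powr complex_of_real \<mu>"
  have "(\<lambda>n. hankel_integral (F n) \<epsilon> \<alpha>) sums hankel_integral (bessel_kernel w \<mu>) \<epsilon> \<alpha>"
    by (rule hankel_integral_sums(2)[OF w(1,2) \<epsilon>' int summ le sums])
  moreover have "hankel_integral (F n) \<epsilon> \<alpha> =
      K * ((w / 2) ^ (2 * n) / fact n * rGamma (complex_of_real \<mu> + of_nat n + 1))" for n
  proof -
    have e: "\<mu> + real n + 1 - 1 = \<mu> + real n"
      "complex_of_real (\<mu> + real n + 1) = complex_of_real \<mu> + of_nat n + 1"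
      by simp_all
    have p: "(w / 2) powr complex_of_real (\<mu> + real n) = (w / 2) powr complex_of_real \<mu> * (w / 2) ^ n"
      using w(1) by (simp add: powr_add powr_nat')
    have "(w / 2) ^ (2 * n) = (w / 2) ^ n * (w / 2) ^ n"
      by (simp only: mult_2 power_add)
    then show ?thesis
      unfolding F_def hankel_integral_cmult hankel_integral_exp_kernel[OF w \<epsilon>' s] e p K_def
      by (simp only: mult_ac times_divide_eq_left times_divide_eq_right)
  qed
  ultimately have "(\<lambda>n. K * ((w / 2) ^ (2 * n) / fact n * rGamma (complex_of_real \<mu> + of_nat n + 1)) / K) sums
      (hankel_integral (bessel_kernel w \<mu>) \<epsilon> \<alpha> / K)"
    by (intro sums_divide) simp
  moreover have K: "K \<noteq> 0"
    using w(1) by (simp add: K_def)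
  ultimately have "norm_bessel_I \<mu> w = hankel_integral (bessel_kernel w \<mu>) \<epsilon> \<alpha> / K"
    unfolding norm_bessel_I_def by (simp only: nonzero_mult_div_cancel_left sums_iff simp_thms)
  then show "hankel_integral (bessel_kernel w \<mu>) \<epsilon> \<alpha> =
      2 * pi * \<i> * (w / 2) powr complex_of_real \<mu> * norm_bessel_I \<mu> w"
    using K unfolding K_def[symmetric] by simp
qed

section \<open>The contour integral for \<open>script_I\<close>\<close>

theorem theorem3p1:
  fixes b \<nu> t \<epsilon> \<alpha> :: real and w :: complex
  assumes "b > 0" and "1 + b * \<nu> > 0"
    and "w \<noteq> 0" and "w = rcis (norm w) \<alpha>" and "- pi < \<alpha>" and "\<alpha> \<le> pi"
    and "t \<in> {-1..1}" and "\<epsilon> > 0"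
  shows "hankel_integrable (contour_integrand b \<nu> w t) \<epsilon> \<alpha> \<and>
    script_I b \<nu> w t =
      complex_of_real (Gamma (b * \<nu> + 1)) / (2 * complex_of_real pi * \<i>) *
      real_pow (w / 2) (- (b * \<nu>)) *
      hankel_integral (contour_integrand b \<nu> w t) \<epsilon> \<alpha>"
proof -
  define C where "C = (\<lambda>m. norm_gegenbauer \<nu> m t)"
  \<comment> \<open>The factor z^(-b m) raises the index of the Bessel kernel from b \<nu> to b (m +
    \<nu>), so each term is again a Schlaefli integrand.\<close>
  define F where "F = (\<lambda>m r \<theta>. complex_of_real (C m) * bessel_kernel w (b * (real m + \<nu>)) r \<theta>)"
  \<comment> \<open>The largest modulus of x = z^(-b) on the contour, attained on the
    circle.\<close>
  define q where "q = (1 + \<epsilon>) powr (- b)"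
  have t: "\<bar>t\<bar> \<le> 1" using assms(7) by auto
  have \<epsilon>: "\<epsilon> > -1" using assms(8) by simp
  have q: "0 \<le> q" "q < 1"
    using assms(1,8) by (simp_all add: q_def powr_less_one)
  have \<mu>: "b * (real m + \<nu>) > -1" for m
  proof -
    have "0 \<le> b * real m" using assms(1) by simp
    then show ?thesis using assms(2) by (simp add: distrib_left)
  qed
  note kernel = hankel_integral_bessel_kernel[OF assms(3-6,8) \<mu>]
  have int: "hankel_integrable (F m) \<epsilon> \<alpha>" for m
    unfolding F_def by (intro hankel_integrable_cmult kernel)
  \<comment> \<open>The factor \<open>exp (norm w / 2)\<close> will bound exp(w / (2 z)), as |z| >=
    1.\<close>
  have summ: "summable (\<lambda>m. exp (norm w / 2) * (\<bar>C m\<bar> * q ^ m))"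
    unfolding C_def by (intro summable_mult summable_norm_gegenbauer t q)
  have F: "F m r \<theta> = C m * polar_pow r \<theta> (- b) ^ m * bessel_kernel w (b * \<nu>) r \<theta>" if "r > 0" for m r \<theta>
  proof -
    have "polar_pow r \<theta> (- (b * (real m + \<nu>))) = polar_pow r \<theta> (real m * - b + - (b * \<nu>))"
      by (simp add: algebra_simps)
    also have "\<dots> = polar_pow r \<theta> (- b) ^ m * polar_pow r \<theta> (- (b * \<nu>))"
      unfolding polar_pow_add polar_pow_of_nat_mult[OF that] ..
    finally show ?thesis
      unfolding F_def bessel_kernel_def by simp
  qed
  have le: "norm (F m r \<theta>) \<le> exp (norm w / 2) * (\<bar>C m\<bar> * q ^ m) * exp (Re (w / 2 * rcis r \<theta>))"
    if r: "r \<ge> 1 + \<epsilon>" for m r \<theta>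
  proof -
    have r1: "r \<ge> 1" using r assms(8) by simp
    have "norm (polar_pow r \<theta> (- b)) \<le> q"
      using assms(1,8) r unfolding norm_polar_pow q_def by (intro powr_mono2') auto
    then have 1: "norm (polar_pow r \<theta> (- b) ^ m) \<le> q ^ m"
      unfolding norm_power by (intro power_mono) simp_all
    have 2: "norm (bessel_kernel w (b * \<nu>) r \<theta>) \<le> exp (norm w / 2) * exp (Re (w / 2 * rcis r \<theta>))"
    proof -
      \<comment> \<open>The factor 1/z from dz/z is kept with the power: the exponent - b \<nu> - 1
        is negative by assumption, while - b \<nu> alone may be positive.\<close>
      have "norm (polar_pow r \<theta> (- (b * \<nu>)) / rcis r \<theta>) = r powr (- (b * \<nu> + 1))"
        using r1 by (simp add: norm_divide norm_polar_pow powr_diff)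
      also have "\<dots> \<le> 1"
        using powr_mono[of "- (b * \<nu> + 1)" 0 r] assms(2) r1 by simp
      finally have 3: "norm (polar_pow r \<theta> (- (b * \<nu>)) / rcis r \<theta>) \<le> 1" .
      have "Re (w / 2 * (1 / rcis r \<theta>)) \<le> norm (w / 2 * (1 / rcis r \<theta>))"
        by (rule complex_Re_le_cmod)
      also have "\<dots> \<le> norm w / 2"
        using r1 mult_left_le[of "1 / r" "norm w / 2"] by (simp add: norm_mult norm_divide)
      finally have 4: "exp (Re (w / 2 * (1 / rcis r \<theta>))) \<le> exp (norm w / 2)" by simp
      have "norm (bessel_kernel w (b * \<nu>) r \<theta>) =
          norm (polar_pow r \<theta> (- (b * \<nu>)) / rcis r \<theta>) *
          (exp (Re (w / 2 * (1 / rcis r \<theta>))) * exp (Re (w / 2 * rcis r \<theta>)))"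
        unfolding bessel_kernel_def distrib_left exp_add norm_mult norm_divide norm_exp_eq_Re by simp
      also have "\<dots> \<le> 1 * (exp (norm w / 2) * exp (Re (w / 2 * rcis r \<theta>)))"
        by (intro mult_mono 3 4) simp_all
      finally show ?thesis by simp
    qed
    have "norm (F m r \<theta>) = \<bar>C m\<bar> * norm (polar_pow r \<theta> (- b) ^ m) * norm (bessel_kernel w (b * \<nu>) r \<theta>)"
      using r1 by (simp add: F norm_mult)
    also have "\<dots> \<le> \<bar>C m\<bar> * q ^ m * (exp (norm w / 2) * exp (Re (w / 2 * rcis r \<theta>)))"
      using q by (intro mult_mono 1 2) simp_all
    finally show ?thesis by (simp add: mult_ac)
  qed
  have sums: "(\<lambda>m. F m r \<theta>) sums contour_integrand b \<nu> w t r \<theta>" if r: "r \<ge> 1 + \<epsilon>" for r \<theta>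
  proof -
    have r1: "r > 1" "r > 0" using r assms(8) by simp_all
    define x where "x = polar_pow r \<theta> (- b)"
    have x: "norm x < 1"
      using r1 assms(1) by (simp add: x_def norm_polar_pow powr_less_one)
    have x2: "polar_pow r \<theta> (- 2 * b) = x\<^sup>2"
      using polar_pow_of_nat_mult[OF r1(2), of \<theta> 2 "- b"] by (simp add: x_def)
    have "(\<lambda>m. complex_of_real (C m) * x ^ m * bessel_kernel w (b * \<nu>) r \<theta>) sums
      ((1 - x\<^sup>2) / (1 - 2 * complex_of_real t * x + x\<^sup>2) powr complex_of_real (\<nu> + 1) *
        bessel_kernel w (b * \<nu>) r \<theta>)"
      unfolding C_def by (intro sums_mult2 norm_gegenbauer_sums t x)
    then show ?thesis
      unfolding F[OF r1(2)] contour_integrand_def x2 x_def[symmetric]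
      by (simp add: bessel_kernel_def mult_ac)
  qed
  have integrable: "hankel_integrable (contour_integrand b \<nu> w t) \<epsilon> \<alpha>"
    by (rule hankel_integral_sums(1)[OF assms(3,4) \<epsilon> int summ le sums])
  define B where "B = (\<lambda>m. real_pow (w / 2) (b * real m) * norm_bessel_I (b * (real m + \<nu>)) w * complex_of_real (C m))"
  have "(\<lambda>m. hankel_integral (F m) \<epsilon> \<alpha>) sums hankel_integral (contour_integrand b \<nu> w t) \<epsilon> \<alpha>"
    by (rule hankel_integral_sums(2)[OF assms(3,4) \<epsilon> int summ le sums])
  then have "(\<lambda>m. real_pow (w / 2) (- (b * \<nu>)) / (2 * complex_of_real pi * \<i>) * hankel_integral (F m) \<epsilon> \<alpha>) sums
      (real_pow (w / 2) (- (b * \<nu>)) / (2 * complex_of_real pi * \<i>) *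
        hankel_integral (contour_integrand b \<nu> w t) \<epsilon> \<alpha>)"
    by (rule sums_mult)
  moreover have "real_pow (w / 2) (- (b * \<nu>)) / (2 * complex_of_real pi * \<i>) * hankel_integral (F m) \<epsilon> \<alpha> = B m" for m
  proof -
    have rp: "real_pow (w / 2) s = (w / 2) powr complex_of_real s" for s
      using assms(3) by (simp add: real_pow_def)
    \<comment> \<open>The prefactor lowers the power b (m + \<nu>) from Schlaefli's integral to the
      power b m of the series.\<close>
    have "- (b * \<nu>) + b * (real m + \<nu>) = b * real m"
      by (simp add: algebra_simps)
    then have "(w / 2) powr complex_of_real (- (b * \<nu>)) * (w / 2) powr complex_of_real (b * (real m + \<nu>)) =
        (w / 2) powr complex_of_real (b * real m)"
      by (metis of_real_add powr_add)
    then show ?thesis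
      unfolding B_def F_def hankel_integral_cmult kernel(2) rp by (simp add: field_simps)
  qed
  ultimately have "(\<Sum>m. B m) = real_pow (w / 2) (- (b * \<nu>)) / (2 * complex_of_real pi * \<i>) *
      hankel_integral (contour_integrand b \<nu> w t) \<epsilon> \<alpha>"
    by (simp add: sums_iff)
  then have "script_I b \<nu> w t =
      complex_of_real (Gamma (b * \<nu> + 1)) / (2 * complex_of_real pi * \<i>) *
      real_pow (w / 2) (- (b * \<nu>)) *
      hankel_integral (contour_integrand b \<nu> w t) \<epsilon> \<alpha>"
    unfolding script_I_def B_def C_def by simp
  with integrable show ?thesis by blast
qed

end
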